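(* Let $P=(P(x,y):x,y\in S)$ be the transition matrix of an irreducible positive recurrent Markov chain on a countably infinite state space $S$, with unique stationary distribution $\pi=(\pi(x):x\in S)$. Assume that there exist a function $g:S\to\mathbb{R}_+$, a constant $b<\infty$, and a coercive function $r:S\to\mathbb{R}_+$ such that $$\sum_{y\in S}P(x,y)g(y)\le g(x)-r(x)+b\qquad\text{for all }x\in S.$$ Put $A_n=K_n(g)=\{x\in S: g(x)\le n\}$ for $n\ge 1$. For every $n\geq 1$ with $A_n\neq\emptyset$, let $P_n$ be an arbitrary general augmentation of $P$ on $A_n$, and let $\pi_n\in\Pi_n$ be an arbitrary stationary distribution of $P_n$. Then $$\sum_{x\in A_n}|\pi_n(x)-\pi(x)|\to 0\qquad\text{as } n\to\infty .$$
   Context: A function $f:S\to\mathbb{R}_+$ on a countable set $S$ is coercive if for each $m\ge 1$ the sublevel set $K_m(f)=\{x\in S: f(x)\le m\}$ is finite. For a subset $A_n\subseteq S$, a general augmentation of (the truncation to $A_n$ of) $P$ is a stochastic matrix $P_n=(P_n(x,y):x,y\in A_n)$ on $A_n$ such that $P_n(x,y)\ge P(x,y)$ for all $x,y\in A_n$. (Under the hypotheses, each $A_n=K_n(g)$ is finite.) $\Pi_n$ denotes the set of all stationary distributions of $P_n$ on $A_n$, i.e. probability vectors $\pi_n$ on $A_n$ with $\pi_n P_n=\pi_n$. *)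

theory Defs
  imports "HOL-Analysis.Analysis"
begin

text \<open>
  A matrix indexed by a set \<open>A\<close> is a function \<open>'a \<Rightarrow> 'a \<Rightarrow> real\<close>, and a vector indexed by \<open>A\<close> is
  a function \<open>'a \<Rightarrow> real\<close>; values outside \<open>A\<close> are never referred to.
\<close>

definition sublevel :: "'a set \<Rightarrow> ('a \<Rightarrow> real) \<Rightarrow> nat \<Rightarrow> 'a set" where
  "sublevel S f m = {x \<in> S. f x \<le> real m}"

definition coercive :: "'a set \<Rightarrow> ('a \<Rightarrow> real) \<Rightarrow> bool" where
  "coercive S f \<longleftrightarrow> (\<forall>m\<ge>1. finite (sublevel S f m))"

definition stochastic_matrix :: "'a set \<Rightarrow> ('a \<Rightarrow> 'a \<Rightarrow> real) \<Rightarrow> bool" where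
  "stochastic_matrix A Q \<longleftrightarrow>
     (\<forall>x\<in>A. (\<forall>y\<in>A. 0 \<le> Q x y) \<and> ((\<lambda>y. Q x y) has_sum 1) A)"

definition prob_vector :: "'a set \<Rightarrow> ('a \<Rightarrow> real) \<Rightarrow> bool" where
  "prob_vector A \<nu> \<longleftrightarrow> (\<forall>x\<in>A. 0 \<le> \<nu> x) \<and> (\<nu> has_sum 1) A"

definition stationary_distribution :: "'a set \<Rightarrow> ('a \<Rightarrow> 'a \<Rightarrow> real) \<Rightarrow> ('a \<Rightarrow> real) \<Rightarrow> bool" where
  "stationary_distribution A Q \<nu> \<longleftrightarrow>
     prob_vector A \<nu> \<and> (\<forall>y\<in>A. ((\<lambda>x. \<nu> x * Q x y) has_sum \<nu> y) A)"

definition augmentation ::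
  "('a \<Rightarrow> 'a \<Rightarrow> real) \<Rightarrow> 'a set \<Rightarrow> ('a \<Rightarrow> 'a \<Rightarrow> real) \<Rightarrow> bool" where
  "augmentation P A Q \<longleftrightarrow> stochastic_matrix A Q \<and> (\<forall>x\<in>A. \<forall>y\<in>A. P x y \<le> Q x y)"

primrec n_step :: "'a set \<Rightarrow> ('a \<Rightarrow> 'a \<Rightarrow> real) \<Rightarrow> nat \<Rightarrow> 'a \<Rightarrow> 'a \<Rightarrow> real" where
  "n_step S P 0 x y = (if x = y then 1 else 0)"
| "n_step S P (Suc n) x y = (\<Sum>\<^sub>\<infinity>z\<in>S. P x z * n_step S P n z y)"

definition irreducible_matrix :: "'a set \<Rightarrow> ('a \<Rightarrow> 'a \<Rightarrow> real) \<Rightarrow> bool" where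
  "irreducible_matrix S P \<longleftrightarrow> (\<forall>x\<in>S. \<forall>y\<in>S. \<exists>n. n_step S P n x y > 0)"

text \<open>
  \<open>first_passage S P y n x\<close> is the probability that the chain started in \<open>x\<close> satisfies
  \<open>\<tau> = n\<close>, where \<open>\<tau> = inf {n \<ge> 1. X n = y}\<close>.
\<close>

fun first_passage :: "'a set \<Rightarrow> ('a \<Rightarrow> 'a \<Rightarrow> real) \<Rightarrow> 'a \<Rightarrow> nat \<Rightarrow> 'a \<Rightarrow> real" where
  "first_passage S P y 0 x = 0"
| "first_passage S P y (Suc 0) x = P x y"
| "first_passage S P y (Suc (Suc n)) x =
     (\<Sum>\<^sub>\<infinity>z\<in>S - {y}. P x z * first_passage S P y (Suc n) z)"

text \<open>
  Every state is positive recurrent: the return time to \<open>x\<close> is almost surely finite (first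
  conjunct) and has finite expectation (second conjunct).
\<close>

definition positive_recurrent :: "'a set \<Rightarrow> ('a \<Rightarrow> 'a \<Rightarrow> real) \<Rightarrow> bool" where
  "positive_recurrent S P \<longleftrightarrow>
     (\<forall>x\<in>S. (\<lambda>n. first_passage S P x n x) sums 1 \<and>
            summable (\<lambda>n. real n * first_passage S P x n x))"

end

theory Submission
  imports Defs "HOL-Complex_Analysis.Great_Picard"
begin

text \<open>
  The drift inequality survives augmentation, because the redistributed mass lands where
  \<open>g \<le> n\<close> while it was lost where \<open>g > n\<close>. Integrating it against \<open>\<pi>n n\<close> bounds the
  \<open>\<pi>n n\<close>-mean of \<open>r\<close> by \<open>b\<close>, so that the family is tight. A pointwise subsequential limit is
  therefore a probability vector; it is subinvariant under \<open>P\<close>, hence invariant since the total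
  mass is finite, hence equal to \<open>\<pi>\<close>. Scheffe's argument upgrades pointwise convergence to
  convergence in total variation.
\<close>

section \<open>Subinvariant vectors\<close>

lemma has_sum_diff:
  fixes f g :: "'a \<Rightarrow> 'b::topological_ab_group_add"
  assumes "(f has_sum a) A" "(g has_sum b) A"
  shows "((\<lambda>x. f x - g x) has_sum (a - b)) A"
  using has_sum_add[OF assms(1), of "\<lambda>x. - g x" "- b"] assms(2) by (simp add: has_sum_uminus)

text \<open>The rows of \<open>P\<close> sum to 1, so by Fubini \<open>\<mu>\<close> and its image
  under \<open>P\<close> have the same finite total mass. The defect \<open>\<mu> y - q y\<close> is
  therefore nonnegative with total 0, hence 0 everywhere. Subinvariance is stated through finite
  partial sums because these pass to pointwise limits and give the summability of each
  column.\<close>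

lemma subinvariant_imp_invariant:
  fixes \<mu> :: "'a \<Rightarrow> real"
  assumes P: "stochastic_matrix S P"
    and nonneg: "\<And>x. x \<in> S \<Longrightarrow> 0 \<le> \<mu> x"
    and summ: "\<mu> summable_on S"
    and sub: "\<And>F y. finite F \<Longrightarrow> F \<subseteq> S \<Longrightarrow> y \<in> S \<Longrightarrow> (\<Sum>x\<in>F. \<mu> x * P x y) \<le> \<mu> y"
    and "y \<in> S"
  shows "((\<lambda>x. \<mu> x * P x y) has_sum \<mu> y) S"
proof -
  define M where "M = infsum \<mu> S"
  define q where "q y = (\<Sum>\<^sub>\<infinity>x\<in>S. \<mu> x * P x y)" for y
  have M: "(\<mu> has_sum M) S"
    unfolding M_def using summ by simp
  have P0: "0 \<le> P x y" and P1: "(P x has_sum 1) S" if "x \<in> S" "y \<in> S" for x y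
    using P that by (auto simp: stochastic_matrix_def)
  have q: "((\<lambda>x. \<mu> x * P x y) has_sum q y) S" if "y \<in> S" for y
    unfolding q_def
  proof (rule has_sum_infsum, rule nonneg_bdd_above_summable_on)
    show "bdd_above (sum (\<lambda>x. \<mu> x * P x y) ` {F. F \<subseteq> S \<and> finite F})"
      using sub that by (intro bdd_aboveI[of _ "\<mu> y"]) auto
  qed (use nonneg P0 that in auto)
  have q_le: "q y \<le> \<mu> y" if "y \<in> S" for y
    using has_sum_le_finite_sums[OF q[OF that]] sub that by blast
  have inner: "((\<lambda>y. (\<lambda>(x, y). \<mu> x * P x y) (x, y)) has_sum \<mu> x) S" if "x \<in> S" for x
    using has_sum_cmult_right[OF P1[OF that that], of "\<mu> x"] by simp
  \<comment> \<open>Summation over \<open>y\<close> first gives the total \<open>M\<close>; after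
    the swap below, summation over \<open>x\<close> first shows that \<open>q\<close> has the same
    total.\<close>
  have "((\<lambda>(x, y). \<mu> x * P x y) has_sum M) (S \<times> S)"
    by (rule has_sum_SigmaI[OF inner M], assumption)
      (rule summable_on_SigmaI[OF inner summ], use nonneg P0 in auto)
  then have "((\<lambda>(y, x). \<mu> x * P x y) has_sum M) (S \<times> S)"
    by (subst (asm) has_sum_swap) (simp add: case_prod_unfold)
  then have "(q has_sum M) S"
    by (rule has_sum_SigmaD) (use q in simp)
  then have "((\<lambda>y. \<mu> y - q y) has_sum 0) S"
    using has_sum_diff[OF M] by fastforce
  then have "\<mu> y - q y = 0"
    by (rule nonneg_has_sum_le_0D) (use q_le \<open>y \<in> S\<close> in auto)
  then show ?thesis
    using q[OF \<open>y \<in> S\<close>] by simp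
qed

lemma n_step_nonneg:
  assumes "stochastic_matrix S P" "x \<in> S"
  shows "0 \<le> n_step S P n x y"
  using assms(2)
proof (induction n arbitrary: x)
  case (Suc n)
  then show ?case
    using assms(1) by (auto simp: stochastic_matrix_def intro!: infsum_nonneg)
qed auto

text \<open>Positivity travels along paths of positive probability: a positive \<open>n_step\<close>
  entry contains a first step to some \<open>z\<close> with \<open>P x z > 0\<close>, and the single
  summand \<open>\<nu> x * P x z\<close> is already a lower bound for
  \<open>\<nu> z\<close>.\<close>

lemma invariant_pos_step:
  fixes \<nu> :: "'a \<Rightarrow> real"
  assumes P: "stochastic_matrix S P"
    and nonneg: "\<And>x. x \<in> S \<Longrightarrow> 0 \<le> \<nu> x"
    and inv: "\<And>y. y \<in> S \<Longrightarrow> ((\<lambda>x. \<nu> x * P x y) has_sum \<nu> y) S"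
    and "x \<in> S" "y \<in> S" "0 < \<nu> x" "0 < n_step S P n x y"
  shows "0 < \<nu> y"
  using assms(4,6,7)
proof (induction n arbitrary: x)
  case 0
  then show ?case
    by (auto split: if_splits)
next
  case (Suc n)
  have P0: "0 \<le> P x y" if "x \<in> S" "y \<in> S" for x y
    using P that by (auto simp: stochastic_matrix_def)
  have "\<exists>z\<in>S. 0 < P x z * n_step S P n z y"
  proof (rule ccontr)
    assume "\<not> ?thesis"
    then have "\<And>z. z \<in> S \<Longrightarrow> P x z * n_step S P n z y = 0"
      using P0[OF \<open>x \<in> S\<close>] n_step_nonneg[OF P]
      by (metis less_eq_real_def mult_nonneg_nonneg)
    then show False
      using Suc.prems by (simp add: infsum_0 del: mult_eq_0_iff)
  qed
  then obtain z where z: "z \<in> S" "0 < P x z" "0 < n_step S P n z y"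
    using P0[OF \<open>x \<in> S\<close>] by (metis zero_less_mult_pos less_eq_real_def mult_zero_left less_irrefl)
  have "\<nu> x * P x z \<le> \<nu> z"
    using finite_sum_le_has_sum[OF inv[OF z(1)], of "{x}"] nonneg P0 z Suc.prems by simp
  then have "0 < \<nu> z"
    using z Suc.prems by (metis mult_pos_pos order_less_le_trans)
  then show ?case
    using Suc.IH z by blast
qed

text \<open>
  The pointwise minimum of two invariant vectors is subinvariant, so that the positive and
  negative parts of their difference are invariant; by irreducibility, one of them vanishes.
\<close>

lemma subinvariant_unique:
  fixes \<mu> \<pi> :: "'a \<Rightarrow> real"
  assumes P: "stochastic_matrix S P" and irr: "irreducible_matrix S P"
    and mu: "prob_vector S \<mu>" and pi: "stationary_distribution S P \<pi>"
    and sub: "\<And>F y. finite F \<Longrightarrow> F \<subseteq> S \<Longrightarrow> y \<in> S \<Longrightarrow> (\<Sum>x\<in>F. \<mu> x * P x y) \<le> \<mu> y"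
    and "x \<in> S"
  shows "\<mu> x = \<pi> x"
proof -
  define m where "m x = min (\<mu> x) (\<pi> x)" for x
  have P0: "0 \<le> P x y" if "x \<in> S" "y \<in> S" for x y
    using P that by (auto simp: stochastic_matrix_def)
  have mu0: "0 \<le> \<mu> x" and pi0: "0 \<le> \<pi> x" if "x \<in> S" for x
    using mu pi that by (auto simp: stationary_distribution_def prob_vector_def)
  have mu1: "(\<mu> has_sum 1) S" and pi1: "(\<pi> has_sum 1) S"
    using mu pi by (auto simp: stationary_distribution_def prob_vector_def)
  have pi_inv: "((\<lambda>x. \<pi> x * P x y) has_sum \<pi> y) S" if "y \<in> S" for y
    using pi that by (auto simp: stationary_distribution_def)
  have mu_inv: "((\<lambda>x. \<mu> x * P x y) has_sum \<mu> y) S" if "y \<in> S" for y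
    using subinvariant_imp_invariant[OF P mu0 _ sub that] mu1 by (auto simp: summable_on_def)
  have m_inv: "((\<lambda>x. m x * P x y) has_sum m y) S" if "y \<in> S" for y
  proof (rule subinvariant_imp_invariant[OF P _ _ _ that])
    show "m summable_on S"
      by (rule summable_on_comparison_test[of \<mu>])
        (use mu1 mu0 pi0 in \<open>auto simp: m_def summable_on_def\<close>)
    fix F y assume F: "finite F" "F \<subseteq> S" "y \<in> S"
    have "(\<Sum>x\<in>F. m x * P x y) \<le> (\<Sum>x\<in>F. \<mu> x * P x y)"
      by (intro sum_mono mult_right_mono) (use F P0 in \<open>auto simp: m_def\<close>)
    moreover have "(\<Sum>x\<in>F. m x * P x y) \<le> (\<Sum>x\<in>F. \<pi> x * P x y)"
      by (intro sum_mono mult_right_mono) (use F P0 in \<open>auto simp: m_def\<close>)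
    moreover have "(\<Sum>x\<in>F. \<pi> x * P x y) \<le> \<pi> y"
      by (rule finite_sum_le_has_sum[OF pi_inv]) (use F P0 pi0 in auto)
    ultimately show "(\<Sum>x\<in>F. m x * P x y) \<le> m y"
      using sub[OF F] by (simp add: m_def)
  qed (use mu0 pi0 in \<open>auto simp: m_def\<close>)
  have inv: "((\<lambda>x. (\<mu> x - m x) * P x y) has_sum (\<mu> y - m y)) S"
            "((\<lambda>x. (\<pi> x - m x) * P x y) has_sum (\<pi> y - m y)) S" if "y \<in> S" for y
    using has_sum_diff[OF mu_inv m_inv, OF that that] has_sum_diff[OF pi_inv m_inv, OF that that]
    by (simp_all add: left_diff_distrib)
  have pos: "0 < \<mu> y - m y" if "x \<in> S" "y \<in> S" "0 < \<mu> x - m x" for x y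
  proof -
    from irr that(1,2) obtain n where "0 < n_step S P n x y"
      by (auto simp: irreducible_matrix_def)
    then show ?thesis
      using invariant_pos_step[OF P _ inv(1) that] by (simp add: m_def)
  qed
  have pos': "0 < \<pi> y - m y" if "x \<in> S" "y \<in> S" "0 < \<pi> x - m x" for x y
  proof -
    from irr that(1,2) obtain n where "0 < n_step S P n x y"
      by (auto simp: irreducible_matrix_def)
    then show ?thesis
      using invariant_pos_step[OF P _ inv(2) that] by (simp add: m_def)
  qed
  have diff: "((\<lambda>x. \<mu> x - \<pi> x) has_sum 0) S" "((\<lambda>x. \<pi> x - \<mu> x) has_sum 0) S"
    using has_sum_diff[OF mu1 pi1] has_sum_diff[OF pi1 mu1] by simp_all
  \<comment> \<open>If \<open>\<mu> - m\<close> is positive at one state, it is positive at all of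
    them, so the minimum is \<open>\<pi>\<close> everywhere; otherwise it is \<open>\<mu>\<close>
    everywhere. Either way the difference has constant sign, and its total is 0 since both masses
    are 1.\<close>
  consider "\<forall>y\<in>S. 0 \<le> \<mu> y - \<pi> y" | "\<forall>y\<in>S. 0 \<le> \<pi> y - \<mu> y"
  proof (cases "\<exists>y\<in>S. 0 < \<mu> y - m y")
    case True
    then have "\<forall>y\<in>S. 0 < \<mu> y - m y"
      using pos by blast
    then show ?thesis
      by (intro that(1)) (auto simp: m_def min_def split: if_splits)
  next
    case False
    then show ?thesis
      by (intro that(2)) (auto simp: m_def min_def split: if_splits)
  qed
  then show ?thesis
  proof cases
    case 1
    then show ?thesis
      using nonneg_has_sum_le_0D[OF diff(1) _ _ \<open>x \<in> S\<close>] by auto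
  next
    case 2
    then show ?thesis
      using nonneg_has_sum_le_0D[OF diff(2) _ _ \<open>x \<in> S\<close>] by auto
  qed
qed

section \<open>Tightness\<close>

text \<open>The mass that \<open>Q x\<close> adds to \<open>P x\<close> inside \<open>A\<close>
  equals the mass that \<open>P x\<close> carries outside \<open>A\<close>. With \<open>c\<close>
  separating the two ranges of \<open>g\<close>, this mass contributes at most \<open>c\<close> per
  unit inside and at least \<open>c\<close> per unit outside.\<close>

lemma augmentation_mean_le:
  fixes g :: "'a \<Rightarrow> real"
  assumes P: "stochastic_matrix S P" and A: "A \<subseteq> S" "finite A"
    and aug: "augmentation P A Q" and "x \<in> A"
    and below: "\<And>y. y \<in> A \<Longrightarrow> g y \<le> c" and above: "\<And>y. y \<in> S - A \<Longrightarrow> c \<le> g y"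
    and summ: "(\<lambda>y. P x y * g y) summable_on S"
  shows "(\<Sum>y\<in>A. Q x y * g y) \<le> (\<Sum>\<^sub>\<infinity>y\<in>S. P x y * g y)"
proof -
  have "x \<in> S"
    using A \<open>x \<in> A\<close> by auto
  have P0: "\<And>y. y \<in> S \<Longrightarrow> 0 \<le> P x y" and P1: "(P x has_sum 1) S"
    using P \<open>x \<in> S\<close> by (auto simp: stochastic_matrix_def)
  have Q1: "(\<Sum>y\<in>A. Q x y) = 1" and PQ: "\<And>y. y \<in> A \<Longrightarrow> P x y \<le> Q x y"
    using aug \<open>x \<in> A\<close> A by (auto simp: augmentation_def stochastic_matrix_def has_sum_finite_iff)
  have tail: "(P x has_sum (1 - sum (P x) A)) (S - A)"
    by (rule has_sum_Diff[OF P1 _ A(1)]) (use A in \<open>simp add: has_sum_finite_iff\<close>)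
  have tail_g: "((\<lambda>y. P x y * g y) has_sum
      ((\<Sum>\<^sub>\<infinity>y\<in>S. P x y * g y) - (\<Sum>y\<in>A. P x y * g y))) (S - A)"
    by (rule has_sum_Diff[OF has_sum_infsum[OF summ] _ A(1)])
      (use A in \<open>simp add: has_sum_finite_iff\<close>)
  have "(\<Sum>y\<in>A. (Q x y - P x y) * g y) \<le> (\<Sum>y\<in>A. (Q x y - P x y) * c)"
    by (intro sum_mono mult_left_mono) (use below PQ in auto)
  also have "\<dots> = (1 - sum (P x) A) * c"
    by (simp add: Q1 sum_subtractf flip: sum_distrib_right)
  also have "\<dots> \<le> (\<Sum>\<^sub>\<infinity>y\<in>S. P x y * g y) - (\<Sum>y\<in>A. P x y * g y)"
    by (rule has_sum_mono[OF has_sum_cmult_left[OF tail] tail_g])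
      (use P0 above in \<open>auto intro: mult_left_mono\<close>)
  finally show ?thesis
    by (simp add: left_diff_distrib sum_subtractf)
qed

lemma stationary_cost_le:
  fixes g r p :: "'a \<Rightarrow> real"
  assumes P: "stochastic_matrix S P" and A: "A \<subseteq> S" "finite A"
    and aug: "augmentation P A Q" and st: "stationary_distribution A Q p"
    and below: "\<And>y. y \<in> A \<Longrightarrow> g y \<le> c" and above: "\<And>y. y \<in> S - A \<Longrightarrow> c \<le> g y"
    and summ: "\<And>x. x \<in> S \<Longrightarrow> (\<lambda>y. P x y * g y) summable_on S"
    and drift: "\<And>x. x \<in> S \<Longrightarrow> (\<Sum>\<^sub>\<infinity>y\<in>S. P x y * g y) \<le> g x - r x + b"
  shows "(\<Sum>x\<in>A. p x * r x) \<le> b"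
proof -
  have p0: "\<And>x. x \<in> A \<Longrightarrow> 0 \<le> p x" and p1: "sum p A = 1"
    and inv: "\<And>y. y \<in> A \<Longrightarrow> p y = (\<Sum>x\<in>A. p x * Q x y)"
    using st A by (auto simp: stationary_distribution_def prob_vector_def has_sum_finite_iff)
  have "(\<Sum>y\<in>A. p y * g y) = (\<Sum>y\<in>A. \<Sum>x\<in>A. p x * Q x y * g y)"
    using inv by (simp flip: sum_distrib_right)
  also have "\<dots> = (\<Sum>x\<in>A. p x * (\<Sum>y\<in>A. Q x y * g y))"
    by (subst sum.swap) (simp add: sum_distrib_left mult.assoc)
  also have "\<dots> \<le> (\<Sum>x\<in>A. p x * (g x - r x + b))"
  proof (intro sum_mono mult_left_mono)
    fix x assume "x \<in> A"
    then show "(\<Sum>y\<in>A. Q x y * g y) \<le> g x - r x + b"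
      using augmentation_mean_le[OF P A aug _ below above summ] drift A
      by (meson order_trans subsetD)
  qed (use p0 in auto)
  \<comment> \<open>The mean of \<open>g\<close> now stands on both sides and cancels; it is a
    finite sum because \<open>A\<close> is finite.\<close>
  also have "\<dots> = (\<Sum>x\<in>A. p x * g x) - (\<Sum>x\<in>A. p x * r x) + b"
    using p1 by (simp add: algebra_simps sum.distrib sum_subtractf flip: sum_distrib_left sum_distrib_right)
  finally show ?thesis
    by simp
qed

text \<open>Markov's inequality for \<open>r\<close> under \<open>p\<close>: off the sublevel set
  \<open>r\<close> exceeds \<open>m\<close>, so the mass there is at most
  \<open>b / m\<close>.\<close>

lemma sublevel_mass_ge:
  fixes p r :: "'a \<Rightarrow> real"
  assumes A: "finite A" "A \<subseteq> S" and p0: "\<And>x. x \<in> A \<Longrightarrow> 0 \<le> p x" and p1: "sum p A = 1"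
    and r0: "\<And>x. x \<in> S \<Longrightarrow> 0 \<le> r x" and cost: "(\<Sum>x\<in>A. p x * r x) \<le> b" and "0 < m"
  shows "1 - b / real m \<le> sum p (A \<inter> sublevel S r m)"
proof -
  let ?K = "sublevel S r m"
  have "real m * sum p (A - ?K) \<le> (\<Sum>x\<in>A - ?K. p x * r x)"
    unfolding sum_distrib_left using A p0
    by (intro sum_mono) (auto simp: sublevel_def mult.commute[of _ "p _"] intro!: mult_left_mono)
  also have "\<dots> \<le> (\<Sum>x\<in>A. p x * r x)"
    by (rule sum_mono2) (use A p0 r0 in auto)
  finally have "sum p (A - ?K) \<le> b / m"
    using cost \<open>0 < m\<close> by (simp add: field_simps)
  moreover have "sum p A = sum p (A \<inter> ?K) + sum p (A - ?K)"
    using A(1) by (rule sum.Int_Diff)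
  ultimately show ?thesis
    using p1 by simp
qed

section \<open>Convergence\<close>

text \<open>Were some neighbourhood of \<open>L\<close> missed infinitely often, the indices of the
  misses would enumerate a subsequence without any further subsequence tending to
  \<open>L\<close>.\<close>

lemma LIMSEQ_subsubseqI:
  fixes X :: "nat \<Rightarrow> 'a::topological_space"
  assumes "\<And>s. strict_mono s \<Longrightarrow> \<exists>k. strict_mono (k :: nat \<Rightarrow> nat) \<and> (\<lambda>i. X (s (k i))) \<longlonglongrightarrow> L"
  shows "X \<longlonglongrightarrow> L"
proof (rule topological_tendstoI, rule ccontr)
  fix U assume U: "open U" "L \<in> U" and "\<not> (\<forall>\<^sub>F n in sequentially. X n \<in> U)"
  then have "infinite {n. X n \<notin> U}"
    by (simp add: cofinite_eq_sequentially[symmetric] eventually_cofinite)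
  then obtain s :: "nat \<Rightarrow> nat" where s: "strict_mono s" "\<And>n. X (s n) \<notin> U"
    using infinite_enumerate by blast
  obtain k where "(\<lambda>i. X (s (k i))) \<longlonglongrightarrow> L"
    using assms[OF s(1)] by blast
  from topological_tendstoD[OF this U] s(2) show False
    by simp
qed

text \<open>Pointwise limits alone could lose mass at infinity. Coercivity makes each sublevel set
  of \<open>r\<close> finite, so its lower mass bound survives the limit in \<open>n\<close>; then
  \<open>m\<close> tends to infinity.\<close>

lemma prob_vector_limit_of_tight:
  fixes \<nu> :: "nat \<Rightarrow> 'a \<Rightarrow> real"
  assumes coer: "coercive S r"
    and nonneg: "\<And>n x. 0 \<le> \<nu> n x"
    and mass: "\<And>n F. finite F \<Longrightarrow> F \<subseteq> S \<Longrightarrow> sum (\<nu> n) F \<le> 1"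
    and tight: "\<And>m. 0 < m \<Longrightarrow> \<forall>\<^sub>F n in sequentially. 1 - b / real m \<le> sum (\<nu> n) (sublevel S r m)"
    and lim: "\<And>x. x \<in> S \<Longrightarrow> (\<lambda>n. \<nu> n x) \<longlonglongrightarrow> \<mu> x"
  shows "prob_vector S \<mu>"
proof -
  have mu0: "0 \<le> \<mu> x" if "x \<in> S" for x
    using LIMSEQ_le_const[OF lim[OF that]] nonneg by blast
  have sum_lim: "(\<lambda>n. sum (\<nu> n) F) \<longlonglongrightarrow> sum \<mu> F" if "F \<subseteq> S" for F
    using lim that by (intro tendsto_sum) auto
  have sum_le: "sum \<mu> F \<le> 1" if "finite F" "F \<subseteq> S" for F
    using LIMSEQ_le_const2[OF sum_lim[OF that(2)]] mass that by blast
  have summ: "\<mu> summable_on S"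
    by (rule nonneg_bdd_above_summable_on) (use mu0 sum_le in \<open>auto intro!: bdd_aboveI[of _ 1]\<close>)
  have "1 - b / real m \<le> infsum \<mu> S" if "0 < m" for m :: nat
  proof -
    have K: "finite (sublevel S r m)" "sublevel S r m \<subseteq> S"
      using coer that by (auto simp: coercive_def sublevel_def)
    have "1 - b / real m \<le> sum \<mu> (sublevel S r m)"
      by (rule tendsto_lowerbound[OF sum_lim[OF K(2)] tight[OF that]]) simp
    also have "\<dots> \<le> infsum \<mu> S"
      by (rule finite_sum_le_infsum[OF summ K]) (use mu0 in auto)
    finally show ?thesis .
  qed
  then have "\<exists>N. \<forall>m\<ge>N. 1 - b / real m \<le> infsum \<mu> S"
    by (intro exI[of _ 1]) auto
  moreover have "(\<lambda>m. 1 - b / real m) \<longlonglongrightarrow> 1"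
    using tendsto_diff[OF tendsto_const lim_const_over_n[of b]] by simp
  ultimately have "1 \<le> infsum \<mu> S"
    using LIMSEQ_le_const2 by blast
  moreover have "infsum \<mu> S \<le> 1"
    using infsum_le_finite_sums[OF summ] sum_le by blast
  ultimately show ?thesis
    using mu0 summ by (metis has_sum_infsum order_antisym prob_vector_def)
qed

text \<open>A finite set \<open>K\<close> carries nearly all of the mass of \<open>\<pi>\<close>.
  Convergence on \<open>K\<close>, together with total mass 1, leaves little mass of
  \<open>\<nu> n\<close> outside \<open>K\<close> as well.\<close>

lemma Scheffe:
  fixes \<nu> :: "nat \<Rightarrow> 'a \<Rightarrow> real"
  assumes A: "\<forall>\<^sub>F n in sequentially. finite (A n) \<and> A n \<subseteq> S \<and> sum (\<nu> n) (A n) = 1"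
    and nonneg: "\<And>n x. 0 \<le> \<nu> n x"
    and zero: "\<And>n x. x \<notin> A n \<Longrightarrow> \<nu> n x = 0"
    and pi: "prob_vector S \<pi>"
    and lim: "\<And>x. x \<in> S \<Longrightarrow> (\<lambda>n. \<nu> n x) \<longlonglongrightarrow> \<pi> x"
  shows "(\<lambda>n. \<Sum>x\<in>A n. \<bar>\<nu> n x - \<pi> x\<bar>) \<longlonglongrightarrow> 0"
proof (rule order_tendstoI)
  fix e :: real assume "0 < e"
  have pi0: "\<And>x. x \<in> S \<Longrightarrow> 0 \<le> \<pi> x" and pi1: "(\<pi> has_sum 1) S"
    using pi by (auto simp: prob_vector_def)
  obtain K where K: "finite K" "K \<subseteq> S" "1 - e / 2 < sum \<pi> K"
    using has_sum_le_finite_sums[OF pi1, of "1 - e / 2"] \<open>0 < e\<close> by fastforce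
  \<comment> \<open>The three terms bound the error on \<open>K\<close>, the mass of
    \<open>\<nu> n\<close> off \<open>K\<close> and the mass of \<open>\<pi>\<close> off
    \<open>K\<close>. Their limit is \<open>2 * (1 - sum \<pi> K)\<close>, which is below
    \<open>e\<close> by the choice of \<open>K\<close>.\<close>
  have "(\<lambda>n. (\<Sum>x\<in>K. \<bar>\<nu> n x - \<pi> x\<bar>) + (1 - sum (\<nu> n) K) + (1 - sum \<pi> K))
      \<longlonglongrightarrow> (\<Sum>x\<in>K. \<bar>\<pi> x - \<pi> x\<bar>) + (1 - sum \<pi> K) + (1 - sum \<pi> K)"
    by (intro tendsto_intros lim) (use K in auto)
  then have "\<forall>\<^sub>F n in sequentially.
      (\<Sum>x\<in>K. \<bar>\<nu> n x - \<pi> x\<bar>) + (1 - sum (\<nu> n) K) + (1 - sum \<pi> K) < e"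
    by (rule order_tendstoD) (use K in simp)
  then show "\<forall>\<^sub>F n in sequentially. (\<Sum>x\<in>A n. \<bar>\<nu> n x - \<pi> x\<bar>) < e"
    using A
  proof eventually_elim
    case (elim n)
    have "(\<Sum>x\<in>A n. \<bar>\<nu> n x - \<pi> x\<bar>)
        = (\<Sum>x\<in>A n \<inter> K. \<bar>\<nu> n x - \<pi> x\<bar>) + (\<Sum>x\<in>A n - K. \<bar>\<nu> n x - \<pi> x\<bar>)"
      using elim by (intro sum.Int_Diff) auto
    also have "(\<Sum>x\<in>A n \<inter> K. \<bar>\<nu> n x - \<pi> x\<bar>) \<le> (\<Sum>x\<in>K. \<bar>\<nu> n x - \<pi> x\<bar>)"
      by (rule sum_mono2) (use K in auto)
    also have "(\<Sum>x\<in>A n - K. \<bar>\<nu> n x - \<pi> x\<bar>) \<le> (\<Sum>x\<in>A n - K. \<nu> n x + \<pi> x)"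
    proof (rule sum_mono)
      fix x assume "x \<in> A n - K"
      then show "\<bar>\<nu> n x - \<pi> x\<bar> \<le> \<nu> n x + \<pi> x"
        using nonneg[of n x] pi0[of x] elim by auto
    qed
    also have "\<dots> = sum (\<nu> n) (A n - K) + sum \<pi> (A n - K)"
      by (rule sum.distrib)
    also have "sum (\<nu> n) (A n - K) = 1 - sum (\<nu> n) K"
    proof -
      have "sum (\<nu> n) (A n \<inter> K) = sum (\<nu> n) K"
        by (rule sum.mono_neutral_left) (use K zero in auto)
      then show ?thesis
        using elim sum.Int_Diff[of "A n" "\<nu> n" K] by simp
    qed
    also have "sum \<pi> (A n - K) \<le> 1 - sum \<pi> K"
    proof -
      have "sum \<pi> (A n - K) + sum \<pi> K = sum \<pi> (A n \<union> K)"
        using elim K by (subst sum.union_disjoint[symmetric]) auto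
      also have "\<dots> \<le> 1"
        by (rule finite_sum_le_has_sum[OF pi1]) (use elim K pi0 in auto)
      finally show ?thesis by simp
    qed
    finally show ?case
      using elim by linarith
  qed
next
  fix e :: real assume "e < 0"
  then show "\<forall>\<^sub>F n in sequentially. e < (\<Sum>x\<in>A n. \<bar>\<nu> n x - \<pi> x\<bar>)"
    by (intro always_eventually allI order_less_le_trans[OF _ sum_nonneg]) auto
qed

text \<open>Summability of \<open>P x y * g y\<close> is a separate hypothesis because
  \<open>infsum\<close> is 0 on families that are not summable, so that the drift inequality alone
  would not express a finite mean.\<close>

theorem theorem1:
  fixes S :: "'a set"
    and P :: "'a \<Rightarrow> 'a \<Rightarrow> real"
    and \<pi> g r :: "'a \<Rightarrow> real"
    and b :: real
    and A :: "nat \<Rightarrow> 'a set"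
    and Pn :: "nat \<Rightarrow> 'a \<Rightarrow> 'a \<Rightarrow> real"
    and \<pi>n :: "nat \<Rightarrow> 'a \<Rightarrow> real"
  assumes "countable S" and "infinite S"
    and "stochastic_matrix S P"
    and "irreducible_matrix S P"
    and "positive_recurrent S P"
    and "stationary_distribution S P \<pi>"
    and "\<And>x. x \<in> S \<Longrightarrow> 0 \<le> g x"
    and "\<And>x. x \<in> S \<Longrightarrow> 0 \<le> r x"
    and "coercive S r"
    and "\<And>x. x \<in> S \<Longrightarrow> (\<lambda>y. P x y * g y) summable_on S"
    and "\<And>x. x \<in> S \<Longrightarrow> (\<Sum>\<^sub>\<infinity>y\<in>S. P x y * g y) \<le> g x - r x + b"
    and "\<And>n. A n = sublevel S g n"
    and "\<And>n. n \<ge> 1 \<Longrightarrow> A n \<noteq> {} \<Longrightarrow> augmentation P (A n) (Pn n)"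
    and "\<And>n. n \<ge> 1 \<Longrightarrow> A n \<noteq> {} \<Longrightarrow> stationary_distribution (A n) (Pn n) (\<pi>n n)"
  shows "(\<lambda>n. \<Sum>\<^sub>\<infinity>x\<in>A n. \<bar>\<pi>n n x - \<pi> x\<bar>) \<longlonglongrightarrow> 0"
proof -
  note P = assms(3) and g0 = assms(7) and r0 = assms(8) and coer = assms(9)
    and summ = assms(10) and drift = assms(11) and A_def = assms(12)
    and aug = assms(13) and stat = assms(14)
  have P0: "0 \<le> P x y" if "x \<in> S" "y \<in> S" for x y
    using P that by (auto simp: stochastic_matrix_def)
  have AS: "A n \<subseteq> S" for n
    by (auto simp: A_def sublevel_def)
  have finA: "finite (A n)" for n
  proof (rule finite_subset)
    \<comment> \<open>On \<open>A n\<close> the drift inequality with a nonnegative left side gives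
      \<open>r x \<le> g x + b \<le> n + b\<close>. The added 1 guarantees \<open>m \<ge> 1\<close>,
      as \<open>coercive\<close> requires.\<close>
    define m where "m = nat \<lceil>real n + b\<rceil> + 1"
    show "finite (sublevel S r m)"
      using coer by (simp add: coercive_def m_def)
    show "A n \<subseteq> sublevel S r m"
    proof
      fix x assume "x \<in> A n"
      then have x: "x \<in> S" "g x \<le> real n"
        by (auto simp: A_def sublevel_def)
      have "0 \<le> (\<Sum>\<^sub>\<infinity>y\<in>S. P x y * g y)"
        by (rule infsum_nonneg) (use P0 g0 x in auto)
      then have "r x \<le> real n + b"
        using drift[OF x(1)] x by linarith
      also have "\<dots> \<le> real m"
        unfolding m_def by linarith
      finally show "x \<in> sublevel S r m"
        using x by (simp add: sublevel_def)
    qed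
  qed
  have ev_in: "\<forall>\<^sub>F n in sequentially. x \<in> A n" if "x \<in> S" for x
  proof (rule eventually_sequentiallyI)
    fix n assume "nat \<lceil>g x\<rceil> \<le> n"
    then show "x \<in> A n"
      using that unfolding A_def sublevel_def by simp
  qed
  \<comment> \<open>These are the indices at which the hypotheses on \<open>Pn\<close> and
    \<open>\<pi>n\<close> apply.\<close>
  define good where "good n \<longleftrightarrow> 1 \<le> n \<and> A n \<noteq> {}" for n
  obtain x0 where "x0 \<in> S"
    using \<open>infinite S\<close> by fastforce
  have ev_good: "\<forall>\<^sub>F n in sequentially. good n"
    using ev_in[OF \<open>x0 \<in> S\<close>] eventually_ge_at_top[of 1]
    by eventually_elim (auto simp: good_def)
  \<comment> \<open>Extension by 0 puts all the vectors on one common space, nonnegative and of mass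
    at most 1 for every \<open>n\<close>, so that pointwise limits over \<open>S\<close> can be
    taken.\<close>
  define \<nu> where "\<nu> n x = (if good n \<and> x \<in> A n then \<pi>n n x else 0)" for n x
  have \<nu>_stat: "stationary_distribution (A n) (Pn n) (\<nu> n)" if "good n" for n
  proof -
    have "stationary_distribution (A n) (Pn n) (\<pi>n n)"
      using stat that by (simp add: good_def)
    moreover have eq: "\<nu> n x = \<pi>n n x" if "x \<in> A n" for x
      using that \<open>good n\<close> by (simp add: \<nu>_def)
    moreover have "((\<lambda>x. \<nu> n x * Pn n x y) has_sum c) (A n) \<longleftrightarrow>
        ((\<lambda>x. \<pi>n n x * Pn n x y) has_sum c) (A n)" for y c
      by (rule has_sum_cong) (simp add: eq)
    moreover have "(\<nu> n has_sum 1) (A n) \<longleftrightarrow> (\<pi>n n has_sum 1) (A n)"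
      by (rule has_sum_cong) (rule eq)
    ultimately show ?thesis
      by (simp add: stationary_distribution_def prob_vector_def)
  qed
  have \<nu>0: "0 \<le> \<nu> n x" for n x
    using stat[of n] by (auto simp: \<nu>_def good_def stationary_distribution_def prob_vector_def)
  have \<nu>1: "sum (\<nu> n) (A n) = 1" if "good n" for n
  proof -
    have "(\<nu> n has_sum 1) (A n)"
      using \<nu>_stat[OF that] by (simp add: stationary_distribution_def prob_vector_def)
    then show ?thesis
      using finA[of n] by (simp add: has_sum_finite_iff)
  qed
  have \<nu>_mass: "sum (\<nu> n) F \<le> 1" if "finite F" for n F
  proof (cases "good n")
    case True
    have "sum (\<nu> n) F = sum (\<nu> n) (F \<inter> A n)"
      by (rule sum.mono_neutral_right) (use that in \<open>auto simp: \<nu>_def\<close>)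
    also have "\<dots> \<le> sum (\<nu> n) (A n)"
      by (rule sum_mono2) (use finA \<nu>0 in auto)
    finally show ?thesis
      using \<nu>1[OF True] by simp
  qed (simp add: \<nu>_def)
  have \<nu>_tight: "1 - b / real m \<le> sum (\<nu> n) (sublevel S r m)" if "good n" "0 < m" for n m
  proof -
    have cost: "(\<Sum>x\<in>A n. \<nu> n x * r x) \<le> b"
    \<comment> \<open>The separating level \<open>c\<close> is \<open>real n\<close>, since
      \<open>A n\<close> is the sublevel set of \<open>g\<close> at \<open>n\<close>.\<close>
    proof (rule stationary_cost_le[OF P AS finA _ \<nu>_stat[OF that(1)] _ _ summ drift])
      show "augmentation P (A n) (Pn n)"
        using aug that by (simp add: good_def)
    qed (auto simp: A_def sublevel_def)
    have "1 - b / real m \<le> sum (\<nu> n) (A n \<inter> sublevel S r m)"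
      by (rule sublevel_mass_ge[OF finA AS \<nu>0 \<nu>1[OF that(1)] r0 cost that(2)])
    also have "\<dots> \<le> sum (\<nu> n) (sublevel S r m)"
      by (rule sum_mono2) (use coer \<nu>0 that in \<open>auto simp: coercive_def\<close>)
    finally show ?thesis .
  qed
  have \<nu>_sub: "\<forall>\<^sub>F n in sequentially. (\<Sum>x\<in>F. \<nu> n x * P x y) \<le> \<nu> n y"
    if F: "finite F" "F \<subseteq> S" "y \<in> S" for F y
  proof -
    \<comment> \<open>Once \<open>A n\<close> contains \<open>F\<close> and \<open>y\<close>, the
      bound \<open>P \<le> Pn n\<close> and stationarity under \<open>Pn n\<close> give the
      inequality.\<close>
    have "\<forall>\<^sub>F n in sequentially. \<forall>x\<in>F. x \<in> A n"
      using F ev_in by (intro eventually_ball_finite) auto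
    then show ?thesis
      using ev_in[OF F(3)] ev_good
    proof eventually_elim
      case (elim n)
      have Q: "P x y \<le> Pn n x y" if "x \<in> A n" for x
        using aug[of n] elim that by (auto simp: good_def augmentation_def)
      have "(\<Sum>x\<in>F. \<nu> n x * P x y) \<le> (\<Sum>x\<in>F. \<nu> n x * Pn n x y)"
        by (intro sum_mono mult_left_mono) (use elim Q \<nu>0 in auto)
      also have "\<dots> \<le> (\<Sum>x\<in>A n. \<nu> n x * Pn n x y)"
      proof (rule sum_mono2[OF finA])
        fix x assume "x \<in> A n - F"
        then show "0 \<le> \<nu> n x * Pn n x y"
          using Q[of x] P0[of x y] AS[of n] \<nu>0[of n x] F(3) by fastforce
      qed (use elim in auto)
      also have "\<dots> = \<nu> n y"
      proof -
        have "((\<lambda>x. \<nu> n x * Pn n x y) has_sum \<nu> n y) (A n)"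
          using \<nu>_stat[OF elim(3)] elim(2) by (simp add: stationary_distribution_def)
        then show ?thesis
          using finA[of n] by (simp add: has_sum_finite_iff)
      qed
      finally show ?case .
    qed
  qed
  have lim: "(\<lambda>n. \<nu> n x) \<longlonglongrightarrow> \<pi> x" if "x \<in> S" for x
  proof (rule LIMSEQ_subsubseqI)
    fix s :: "nat \<Rightarrow> nat" assume s: "strict_mono s"
    have "norm (\<nu> (s n) y) \<le> 1" for n y
      using \<nu>_mass[of "{y}" "s n"] \<nu>0[of "s n" y] by simp
    \<comment> \<open>Cantor's diagonal extraction: \<open>S\<close> is countable and all values are
      bounded by 1.\<close>
    then obtain k where k: "strict_mono k" "\<And>y. y \<in> S \<Longrightarrow> \<exists>l. (\<lambda>n. \<nu> (s (k n)) y) \<longlonglongrightarrow> l"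
      using function_convergent_subsequence[OF \<open>countable S\<close>, of "\<lambda>n. \<nu> (s n)" 1] by metis
    then obtain \<mu> where \<mu>: "\<And>y. y \<in> S \<Longrightarrow> (\<lambda>n. \<nu> (s (k n)) y) \<longlonglongrightarrow> \<mu> y"
      by metis
    have sub: "filterlim (\<lambda>n. s (k n)) sequentially sequentially"
      using filterlim_compose[OF filterlim_subseq[OF s] filterlim_subseq[OF k(1)]] .
    have "\<mu> x = \<pi> x"
    proof (rule subinvariant_unique[OF P assms(4) _ assms(6) _ that])
      show "prob_vector S \<mu>"
      proof (rule prob_vector_limit_of_tight[OF coer, where \<nu> = "\<lambda>n. \<nu> (s (k n))" and b = b])
        fix m :: nat assume "0 < m"
        then show "\<forall>\<^sub>F n in sequentially. 1 - b / real m \<le> sum (\<nu> (s (k n))) (sublevel S r m)"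
          using eventually_compose_filterlim[OF ev_good sub] \<nu>_tight
          by (auto elim: eventually_mono)
      qed (use \<nu>0 \<nu>_mass \<mu> in auto)
    next
      fix F y assume F: "finite F" "F \<subseteq> S" "y \<in> S"
      show "(\<Sum>x\<in>F. \<mu> x * P x y) \<le> \<mu> y"
      \<comment> \<open>Only the finite sum over \<open>F\<close> is taken to the limit, so no
        exchange with an infinite sum occurs.\<close>
      proof (rule tendsto_le[OF sequentially_bot \<mu>[OF F(3)]])
        show "(\<lambda>n. \<Sum>x\<in>F. \<nu> (s (k n)) x * P x y) \<longlonglongrightarrow> (\<Sum>x\<in>F. \<mu> x * P x y)"
          using F \<mu> by (intro tendsto_intros) auto
        show "\<forall>\<^sub>F n in sequentially. (\<Sum>x\<in>F. \<nu> (s (k n)) x * P x y) \<le> \<nu> (s (k n)) y"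
          using eventually_compose_filterlim[OF \<nu>_sub[OF F] sub] .
      qed
    qed
    then show "\<exists>k. strict_mono (k :: nat \<Rightarrow> nat) \<and> (\<lambda>i. \<nu> (s (k i)) x) \<longlonglongrightarrow> \<pi> x"
      using k(1) \<mu>[OF that] by auto
  qed
  have "(\<lambda>n. \<Sum>x\<in>A n. \<bar>\<nu> n x - \<pi> x\<bar>) \<longlonglongrightarrow> 0"
  proof (rule Scheffe[OF _ \<nu>0 _ _ lim])
    show "\<forall>\<^sub>F n in sequentially. finite (A n) \<and> A n \<subseteq> S \<and> sum (\<nu> n) (A n) = 1"
      using ev_good by eventually_elim (use finA AS \<nu>1 in auto)
    show "prob_vector S \<pi>"
      using assms(6) by (simp add: stationary_distribution_def)
  qed (auto simp: \<nu>_def)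
  \<comment> \<open>For good \<open>n\<close> the extension agrees with \<open>\<pi>n n\<close> on
    \<open>A n\<close>, and \<open>infsum\<close> over the finite set \<open>A n\<close> is an
    ordinary sum.\<close>
  moreover have "\<forall>\<^sub>F n in sequentially.
      (\<Sum>\<^sub>\<infinity>x\<in>A n. \<bar>\<pi>n n x - \<pi> x\<bar>) = (\<Sum>x\<in>A n. \<bar>\<nu> n x - \<pi> x\<bar>)"
    using ev_good by eventually_elim (use finA in \<open>simp add: \<nu>_def\<close>)
  ultimately show ?thesis
    by (simp add: tendsto_cong)
qed

end
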